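(* $$c_4 \ge \frac{1+\sqrt{5}}{12},$$ where $c_4 = \sup\{\lambda_4(G)/n : G \text{ is a graph with } |V(G)| = n,\ n \ge 4\}$ and $\lambda_4(G)$ denotes the fourth largest eigenvalue (counted with multiplicity) of the adjacency matrix of $G$.
   Context: Graphs are finite, simple and undirected. For a graph $G$ on $n$ vertices, the eigenvalues of its adjacency matrix, counted with multiplicity, are denoted $\lambda_1(G) \ge \lambda_2(G) \ge \cdots \ge \lambda_n(G)$. For an integer $k \ge 1$, define $c_k = \sup\{\lambda_k(G)/n : |V(G)| = n,\ n \ge k\}$, the supremum being over all $n \ge k$ and all graphs $G$ on $n$ vertices. *)

theory Defs
  imports
    Complex_Main
    "Graph_Theory.Pair_Digraph"
    "Jordan_Normal_Form.Char_Poly"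
begin

text \<open>
  Finite simple undirected graphs are the \<^const>\<open>pair_graph\<close>s: finite vertex set, no loops, no
  parallel arcs, and every edge \<open>uv\<close> present as both arcs \<open>(u, v)\<close> and \<open>(v, u)\<close>.

  Rows and columns of the adjacency matrix follow the increasing enumeration of the vertex set;
  another enumeration would give a matrix with the same characteristic polynomial.
\<close>

definition adjacency_matrix :: "'a :: linorder pair_pre_digraph \<Rightarrow> real mat" where
  "adjacency_matrix G =
     (let n = card (pverts G); vs = sorted_list_of_set (pverts G)
      in mat n n (\<lambda>(i, j). if (vs ! i, vs ! j) \<in> parcs G then 1 else 0))"

text \<open>
  Eigenvalues are repeated according to their multiplicity as roots of the characteristic polynomial.
  As the adjacency matrix of a graph is real symmetric, this is also the dimension of the eigenspace,
  and the list has one entry per vertex.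
\<close>

definition graph_eigenvalues :: "'a :: linorder pair_pre_digraph \<Rightarrow> real list" where
  "graph_eigenvalues G = rev (sorted_list_of_multiset (proots (char_poly (adjacency_matrix G))))"

text \<open>The index \<open>k\<close> counts from 1; the value is meaningful for \<open>1 \<le> k \<le> card (pverts G)\<close>.\<close>

definition graph_lambda :: "nat \<Rightarrow> 'a :: linorder pair_pre_digraph \<Rightarrow> real" where
  "graph_lambda k G = graph_eigenvalues G ! (k - 1)"

text \<open>
  Up to isomorphism, every finite graph has its vertices in \<^typ>\<open>nat\<close>.  For \<open>k \<ge> 1\<close> the supremum is
  over a nonempty set bounded above by 1, so the real-valued supremum is the intended one.
\<close>

definition c_const :: "nat \<Rightarrow> real" where
  "c_const k = Sup {graph_lambda k G / real (card (pverts G)) | G :: nat pair_pre_digraph.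
                      pair_graph G \<and> card (pverts G) \<ge> k}"

end

theory Submission
  imports Defs
begin

text \<open>
  The bound comes from the closed blow-ups of the icosahedron: replace every vertex by a clique of
  size \<open>t\<close> and every edge by a complete bipartite graph. Adding loops turns the adjacency matrix into
  \<open>(A + I) \<otimes> J\<close>, so an eigenvalue \<open>\<mu>\<close> of the icosahedron becomes the eigenvalue \<open>t (\<mu> + 1) - 1\<close> of
  the blow-up. The icosahedron has the eigenvalue \<open>5\<close> once and \<open>\<surd>5\<close> three times, the eigenvectors of the
  latter being the coordinate functions of the regular icosahedron in \<open>\<real>\<^sup>3\<close>. Hence \<open>\<lambda>\<^sub>4\<close> of the blow-up on
  \<open>12 t\<close> vertices is at least \<open>t (1 + \<surd>5) - 1\<close>; divide by \<open>12 t\<close> and let \<open>t\<close> grow.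
\<close>

section \<open>Roots of characteristic polynomials\<close>

text \<open>For an eigenvector \<open>f\<close> with eigenvalue \<mu>, the right-hand side is
  \<open>f i\<close> times \<open>[:- \<mu>, 1:]\<close>.\<close>

lemma sum_char_poly_matrix_mult_const:
  fixes A :: "'a :: comm_ring_1 mat"
  assumes "A \<in> carrier_mat n n" "i < n"
  shows "(\<Sum>l<n. char_poly_matrix A $$ (i, l) * [:f l:]) =
           [:- (\<Sum>l<n. A $$ (i, l) * f l), f i:]"
proof -
  have "(\<Sum>l<n. char_poly_matrix A $$ (i, l) * [:f l:]) =
          (\<Sum>l<n. (if l = i then [:0, f l:] else 0) + [:- (A $$ (i, l) * f l):])"
    using assms by (intro sum.cong refl) (auto simp: char_poly_matrix_def)
  also have "\<dots> = [:0, f i:] + (\<Sum>l<n. [:- (A $$ (i, l) * f l):])"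
    using assms by (simp add: sum.distrib)
  also have "(\<Sum>l<n. [:- (A $$ (i, l) * f l):]) = [:- (\<Sum>l<n. A $$ (i, l) * f l):]"
    by (induction n) auto
  finally show ?thesis by simp
qed

text \<open>
  Multiplying \<open>x I - A\<close> by a unitriangular matrix whose first \<open>k\<close> columns are the eigenvectors makes the
  first \<open>k\<close> columns divisible by \<open>x - \<mu>\<close>.
\<close>
lemma linear_power_dvd_char_poly:
  fixes A :: "'a :: idom mat"
  assumes A: "A \<in> carrier_mat n n" and k: "k \<le> n"
    and ev: "\<And>i j. i < n \<Longrightarrow> j < k \<Longrightarrow> (\<Sum>l<n. A $$ (i, l) * f j l) = \<mu> * f j i"
    and unit: "\<And>i j. i < k \<Longrightarrow> j < k \<Longrightarrow> f j i = (if i = j then 1 else 0)"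
  shows "[:- \<mu>, 1:] ^ k dvd char_poly A"
proof -
  define N where "N = char_poly_matrix A"
  define P where "P = mat n n (\<lambda>(i, j). if j < k then [:f j i:] else if i = j then 1 else 0)"
  define M where "M = mat n n (\<lambda>(i, j). if j < k then [:f j i:] else N $$ (i, j))"
  define D where "D = mat n n (\<lambda>(i, j). if i = j then if j < k then [:- \<mu>, 1:] else 1 else 0)"
  have carrier: "N \<in> carrier_mat n n" "P \<in> carrier_mat n n" "M \<in> carrier_mat n n" "D \<in> carrier_mat n n"
    using A by (auto simp: N_def P_def M_def D_def)
  \<comment> \<open>Column \<open>j < k\<close> of \<open>N * P\<close> is
    \<open>[:- \<mu>, 1:]\<close> times the constant column \<open>f j\<close>; \<open>D\<close>
    collects these factors and \<open>M\<close> keeps the rest.\<close>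
  have "N * P = M * D"
  proof (rule eq_matI)
    fix i j assume "i < dim_row (M * D)" "j < dim_col (M * D)"
    hence i: "i < n" and j: "j < n" using carrier by auto
    have "(N * P) $$ (i, j) = (\<Sum>l<n. N $$ (i, l) * P $$ (l, j))"
      using carrier i j by (simp add: scalar_prod_def atLeast0LessThan)
    also have "\<dots> = (if j < k then [:- (\<mu> * f j i), f j i:] else N $$ (i, j))"
    proof (cases "j < k")
      case True
      have "(\<Sum>l<n. N $$ (i, l) * P $$ (l, j)) = (\<Sum>l<n. char_poly_matrix A $$ (i, l) * [:f j l:])"
        using True j by (intro sum.cong refl) (simp add: P_def N_def)
      thus ?thesis
        using True by (simp only: sum_char_poly_matrix_mult_const[OF A i] ev[OF i True]) simp
    next
      case False
      have "(\<Sum>l<n. N $$ (i, l) * P $$ (l, j)) = (\<Sum>l<n. if l = j then N $$ (i, l) else 0)"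
        using False j by (intro sum.cong refl) (simp add: P_def)
      thus ?thesis using False j by simp
    qed
    also have "\<dots> = M $$ (i, j) * D $$ (j, j)"
      using i j by (simp add: M_def D_def mult.commute)
    also have "\<dots> = (\<Sum>l<n. if l = j then M $$ (i, l) * D $$ (l, j) else 0)"
      using j by simp
    also have "\<dots> = (\<Sum>l<n. M $$ (i, l) * D $$ (l, j))"
      using j by (intro sum.cong refl) (simp add: D_def)
    also have "\<dots> = (M * D) $$ (i, j)"
      using carrier i j by (simp add: scalar_prod_def atLeast0LessThan)
    finally show "(N * P) $$ (i, j) = (M * D) $$ (i, j)" .
  qed (use carrier in auto)
  \<comment> \<open>\<open>unit\<close> makes the top left \<open>k\<close> by \<open>k\<close>
    block the identity, so \<open>P\<close> is unitriangular; it also encodes the independence of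
    the eigenvectors.\<close>
  moreover have "det P = 1"
  proof -
    have "diag_mat P = replicate n 1"
      using k unit by (intro nth_equalityI) (auto simp: diag_mat_def P_def one_pCons)
    moreover have "P $$ (i, j) = 0" if "i < j" "j < n" for i j
      using that unit by (simp add: P_def)
    ultimately show ?thesis
      using det_lower_triangular[OF _ carrier(2)] by simp
  qed
  moreover have "det D = [:- \<mu>, 1:] ^ k"
  proof -
    have "diag_mat D = replicate k [:- \<mu>, 1:] @ replicate (n - k) 1"
      using k by (intro nth_equalityI) (auto simp: diag_mat_def D_def nth_append)
    moreover have "D $$ (i, j) = 0" if "i < j" "j < n" for i j
      using that by (simp add: D_def)
    ultimately show ?thesis
      using det_lower_triangular[OF _ carrier(4)] by simp
  qed
  ultimately have "char_poly A = det M * [:- \<mu>, 1:] ^ k"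
    using det_mult[OF carrier(1,2)] det_mult[OF carrier(3,4)] by (simp add: char_poly_def N_def)
  thus ?thesis by simp
qed

lemma eigenvalueE_sum:
  fixes A :: "'a :: field mat"
  assumes A: "A \<in> carrier_mat n n" and root: "poly (char_poly A) a = 0"
  obtains v i where "i < n" "v i \<noteq> 0" "\<And>i. i < n \<Longrightarrow> (\<Sum>j<n. A $$ (i, j) * v j) = a * v i"
proof -
  obtain v where "eigenvector A v a"
    using root eigenvalue_root_char_poly[OF A] by (auto simp: eigenvalue_def)
  hence v: "v \<in> carrier_vec n" "v \<noteq> 0\<^sub>v n" "A *\<^sub>v v = a \<cdot>\<^sub>v v"
    using A by (auto simp: eigenvector_def)
  obtain i where "i < n" "v $ i \<noteq> 0"
    using v by (metis carrier_vecD eq_vecI index_zero_vec)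
  moreover have "(\<Sum>j<n. A $$ (i, j) * v $ j) = a * v $ i" if "i < n" for i
    using arg_cong[OF v(3), of "\<lambda>w. w $ i"] that A v(1)
    by (simp add: scalar_prod_def atLeast0LessThan)
  ultimately show thesis using that by blast
qed

text \<open>Compare both sides of the eigenvalue equation at a coordinate where \<open>v\<close> is
  largest in absolute value. This will bound the set whose supremum is
  \<open>c_const\<close>.\<close>

lemma abs_char_poly_root_le:
  fixes A :: "real mat"
  assumes A: "A \<in> carrier_mat n n" and root: "poly (char_poly A) a = 0"
    and entries: "\<And>i j. i < n \<Longrightarrow> j < n \<Longrightarrow> \<bar>A $$ (i, j)\<bar> \<le> 1"
  shows "\<bar>a\<bar> \<le> real n"
proof -
  obtain v i where i: "i < n" "v i \<noteq> 0"
    and ev: "\<And>i. i < n \<Longrightarrow> (\<Sum>j<n. A $$ (i, j) * v j) = a * v i"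
    using eigenvalueE_sum[OF A root] by metis
  define m where "m = Max ((\<lambda>j. \<bar>v j\<bar>) ` {..<n})"
  have le_m: "\<bar>v j\<bar> \<le> m" if "j < n" for j
    using that by (simp add: m_def)
  have "m \<in> (\<lambda>j. \<bar>v j\<bar>) ` {..<n}"
    unfolding m_def using i by (intro Max_in) auto
  then obtain l where l: "l < n" "m = \<bar>v l\<bar>" by auto
  have "m > 0" using le_m[OF i(1)] i(2) by linarith
  have "\<bar>a\<bar> * m = \<bar>\<Sum>j<n. A $$ (l, j) * v j\<bar>"
    using ev[OF l(1)] l(2) by (simp add: abs_mult)
  also have "\<dots> \<le> (\<Sum>j<n. \<bar>A $$ (l, j) * v j\<bar>)" by (rule sum_abs)
  also have "\<dots> \<le> (\<Sum>j<n. 1 * m)"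
    unfolding abs_mult using entries le_m l(1) by (intro sum_mono mult_mono) auto
  finally have "\<bar>a\<bar> * m \<le> real n * m" by simp
  thus ?thesis using \<open>m > 0\<close> by simp
qed

text \<open>The Hermitian form \<open>q\<close> at an eigenvector is \<open>a\<close> times the
  positive squared norm \<open>s\<close>, and symmetry of \<open>A\<close> makes \<open>q\<close>
  real.\<close>

lemma symmetric_char_poly_root_real:
  fixes A :: "real mat"
  assumes A: "A \<in> carrier_mat n n"
    and sym: "\<And>i j. i < n \<Longrightarrow> j < n \<Longrightarrow> A $$ (i, j) = A $$ (j, i)"
    and root: "poly (char_poly (map_mat complex_of_real A)) a = 0"
  shows "a \<in> \<real>"
proof -
  have "map_mat complex_of_real A \<in> carrier_mat n n" using A by simp
  from eigenvalueE_sum[OF this root] obtain v i where i: "i < n" "v i \<noteq> 0"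
    and "\<And>i. i < n \<Longrightarrow> (\<Sum>j<n. map_mat complex_of_real A $$ (i, j) * v j) = a * v i"
    by metis
  hence ev: "(\<Sum>j<n. of_real (A $$ (i, j)) * v j) = a * v i" if "i < n" for i
    using A that by simp
  define s where "s = (\<Sum>i<n. (cmod (v i))\<^sup>2)"
  have "s > 0"
    unfolding s_def using i by (intro sum_pos2[of _ i]) auto
  define q where "q = (\<Sum>i<n. \<Sum>j<n. of_real (A $$ (i, j)) * v j * cnj (v i))"
  have "q = (\<Sum>i<n. a * (v i * cnj (v i)))"
    unfolding q_def by (intro sum.cong refl) (simp add: ev flip: sum_distrib_right)
  also have "\<dots> = a * of_real s"
    by (simp only: s_def of_real_sum complex_norm_square sum_distrib_left)
  finally have q: "q = a * of_real s" .
  have "cnj q = (\<Sum>i<n. \<Sum>j<n. of_real (A $$ (j, i)) * v i * cnj (v j))"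
    unfolding q_def using sym by (auto simp: mult_ac intro!: sum.cong)
  also have "\<dots> = q"
    unfolding q_def by (rule sum.swap)
  finally have "cnj a = a"
    using q \<open>s > 0\<close> by simp
  thus ?thesis by (simp add: Reals_cnj_iff)
qed

text \<open>The characteristic polynomial splits over the complex numbers with real roots only, and
  injectivity of the embedding carries the factorization back to the reals.\<close>

lemma size_proots_symmetric:
  fixes A :: "real mat"
  assumes A: "A \<in> carrier_mat n n"
    and sym: "\<And>i j. i < n \<Longrightarrow> j < n \<Longrightarrow> A $$ (i, j) = A $$ (j, i)"
  shows "size (proots (char_poly A)) = n"
proof -
  let ?B = "map_mat complex_of_real A"
  have "?B \<in> carrier_mat n n" using A by simp
  from char_poly_factorized[OF this] obtain as
    where as: "char_poly ?B = (\<Prod>a\<leftarrow>as. [:- a, 1:])" "length as = n" by auto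
  have "a \<in> \<real>" if "a \<in> set as" for a
    using that by (intro symmetric_char_poly_root_real[OF A sym])
      (auto simp: as poly_prod_list prod_list_zero_iff)
  hence *: "map (\<lambda>a. [:- a, 1:]) as = map (\<lambda>a. map_poly complex_of_real [:- Re a, 1:]) as"
    by (intro map_cong refl) (auto simp: complex_is_Real_iff complex_eq_iff)
  interpret map_poly_inj_idom_hom complex_of_real ..
  have "map_poly complex_of_real (char_poly A) = char_poly ?B"
    by (rule of_real_hom.char_poly_hom[OF A, symmetric])
  also have "\<dots> = map_poly complex_of_real (\<Prod>a\<leftarrow>as. [:- Re a, 1:])"
    unfolding as * by (simp add: hom_prod_list o_def)
  finally have "char_poly A = (\<Prod>a\<leftarrow>as. [:- Re a, 1:])"
    by simp
  also have "proots \<dots> = (\<Sum>a\<leftarrow>as. proots [:- Re a, 1:])"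
    using proots_prod_list[of "map (\<lambda>a. [:- Re a, 1:]) as"]
    by (simp add: o_def image_iff)
  finally show ?thesis using as(2)
    by simp
qed

text \<open>If the entry at index \<open>k - 1\<close> of a descending list is below \<mu>, only the
  \<open>k - 1\<close> entries before it can reach \<mu>.\<close>

lemma nth_rev_sorted_list_of_multiset_ge:
  fixes M :: "'a :: linorder multiset"
  assumes k: "1 \<le> k" "k \<le> size (filter_mset (\<lambda>x. \<mu> \<le> x) M)"
  shows "\<mu> \<le> rev (sorted_list_of_multiset M) ! (k - 1)"
proof (rule ccontr)
  define xs where "xs = rev (sorted_list_of_multiset M)"
  have mset: "mset xs = M" and desc: "sorted (rev xs)" by (simp_all add: xs_def)
  have "size (filter_mset (\<lambda>x. \<mu> \<le> x) M) = length (filter (\<lambda>x. \<mu> \<le> x) xs)"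
    by (simp flip: mset mset_filter)
  also assume "\<not> \<mu> \<le> rev (sorted_list_of_multiset M) ! (k - 1)"
  hence small: "xs ! (k - 1) < \<mu>" by (simp add: xs_def)
  have "\<not> \<mu> \<le> x" if x: "x \<in> set (drop (k - 1) xs)" for x
  proof -
    obtain i where "i < length xs - (k - 1)" "x = xs ! (k - 1 + i)"
      using x by (auto simp: in_set_conv_nth)
    thus ?thesis
      using small sorted_rev_nth_mono[OF desc, of "k - 1" "k - 1 + i"]
      by (simp add: less_diff_conv add.commute)
  qed
  hence "filter (\<lambda>x. \<mu> \<le> x) (drop (k - 1) xs) = []"
    by (simp add: filter_empty_conv)
  hence "filter (\<lambda>x. \<mu> \<le> x) xs = filter (\<lambda>x. \<mu> \<le> x) (take (k - 1) xs)"
    by (metis append.right_neutral append_take_drop_id filter_append)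
  hence "length (filter (\<lambda>x. \<mu> \<le> x) xs) \<le> k - 1"
    using length_filter_le[of _ "take (k - 1) xs"] by (simp add: le_trans)
  finally show False using k by simp
qed

section \<open>Eigenvalues of graphs\<close>

lemma adjacency_matrix_carrier [simp]:
  "adjacency_matrix G \<in> carrier_mat (card (pverts G)) (card (pverts G))"
  by (simp add: adjacency_matrix_def Let_def)

lemma adjacency_matrix_symmetric:
  assumes "pair_graph G" "i < card (pverts G)" "j < card (pverts G)"
  shows "adjacency_matrix G $$ (i, j) = adjacency_matrix G $$ (j, i)"
proof -
  interpret pair_graph G by fact
  have "(u, v) \<in> parcs G \<longleftrightarrow> (v, u) \<in> parcs G" for u v
    using arcs_symmetric by blast
  thus ?thesis using assms by (simp add: adjacency_matrix_def Let_def)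
qed

lemma graph_lambda_le_card:
  assumes G: "pair_graph G" and k: "1 \<le> k" "k \<le> card (pverts G)"
  shows "graph_lambda k G \<le> real (card (pverts G))"
proof -
  let ?p = "char_poly (adjacency_matrix G)"
  \<comment> \<open>The full length makes index \<open>k - 1\<close> valid, so \<open>!\<close>
    returns a genuine root and not an unspecified value.\<close>
  have "length (graph_eigenvalues G) = size (proots ?p)"
    by (metis graph_eigenvalues_def length_rev mset_sorted_list_of_multiset size_mset)
  also have "\<dots> = card (pverts G)"
    using adjacency_matrix_symmetric[OF G]
    by (intro size_proots_symmetric) auto
  finally have "graph_lambda k G \<in> set (graph_eigenvalues G)"
    unfolding graph_lambda_def using k by (intro nth_mem) simp
  hence "graph_lambda k G \<in># proots ?p"
    by (simp add: graph_eigenvalues_def)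
  hence "poly ?p (graph_lambda k G) = 0"
    by (cases "?p = 0") auto
  hence "\<bar>graph_lambda k G\<bar> \<le> real (card (pverts G))"
    by (rule abs_char_poly_root_le[OF adjacency_matrix_carrier])
      (simp add: adjacency_matrix_def Let_def)
  thus ?thesis by simp
qed

lemma c_const_ge:
  fixes G :: "nat pair_pre_digraph"
  assumes "pair_graph G" "1 \<le> k" "k \<le> card (pverts G)"
  shows "graph_lambda k G / real (card (pverts G)) \<le> c_const k"
  unfolding c_const_def
proof (rule cSup_upper)
  show "bdd_above {graph_lambda k G / real (card (pverts G)) | G :: nat pair_pre_digraph.
                     pair_graph G \<and> card (pverts G) \<ge> k}"
    using graph_lambda_le_card \<open>1 \<le> k\<close>
    by (intro bdd_aboveI[of _ 1]) (fastforce simp: divide_le_eq_1)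
qed (use assms in blast)

section \<open>Closed blow-ups\<close>

text \<open>Vertex \<open>i\<close> is a copy of the base vertex \<open>i mod m\<close>. Vertices
  coincide with matrix indices, and the first \<open>m\<close> of them contain each base vertex
  once, so a normalisation on initial base vertices survives lifting.\<close>

definition closed_blowup :: "(nat \<Rightarrow> nat \<Rightarrow> bool) \<Rightarrow> nat \<Rightarrow> nat \<Rightarrow> nat pair_pre_digraph" where
  "closed_blowup R m t =
     \<lparr>pverts = {..<m * t},
      parcs = {(i, j). i < m * t \<and> j < m * t \<and> i \<noteq> j \<and> R (i mod m) (j mod m)}\<rparr>"

lemma card_pverts_closed_blowup [simp]: "card (pverts (closed_blowup R m t)) = m * t"
  by (simp add: closed_blowup_def)

lemma pair_graph_closed_blowup:
  assumes "\<And>a b. R a b \<Longrightarrow> R b a"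
  shows "pair_graph (closed_blowup R m t)"
proof
  have "parcs (closed_blowup R m t) \<subseteq> {..<m * t} \<times> {..<m * t}"
    by (auto simp: closed_blowup_def)
  thus "finite (parcs (closed_blowup R m t))"
    by (rule finite_subset) auto
qed (use assms in \<open>auto simp: closed_blowup_def symmetric_def intro!: symI\<close>)

lemma adjacency_matrix_closed_blowup:
  assumes "i < m * t" "j < m * t"
  shows "adjacency_matrix (closed_blowup R m t) $$ (i, j) =
           (if i \<noteq> j \<and> R (i mod m) (j mod m) then 1 else 0)"
  using assms by (simp add: adjacency_matrix_def closed_blowup_def Let_def lessThan_atLeast0)

lemma sum_mod_blocks:
  fixes g :: "nat \<Rightarrow> 'a :: comm_semiring_1"
  shows "(\<Sum>j<m * t. g (j mod m)) = of_nat t * (\<Sum>l<m. g l)"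
proof (induction t)
  case (Suc t)
  have split: "(\<Sum>j<a + b. h j) = (\<Sum>j<a. h j) + (\<Sum>l<b. h (a + l))" for a b and h :: "nat \<Rightarrow> 'a"
    by (induction b) (simp_all add: add.assoc)
  have "(\<Sum>j<m * Suc t. g (j mod m)) = (\<Sum>j<m * t. g (j mod m)) + (\<Sum>l<m. g (l mod m))"
    using split[of "\<lambda>j. g (j mod m)" "m * t" m] by (simp add: add.commute[of m])
  thus ?case using Suc by (simp add: algebra_simps)
qed simp

text \<open>As \<open>R\<close> includes the diagonal, \<theta> belongs to adjacency plus identity.
  Lifting multiplies it by \<open>t\<close>; removing the loop at \<open>i\<close> subtracts
  1.\<close>

lemma closed_blowup_eigenvector:
  assumes "m > 0" "i < m * t" and refl: "\<And>a. R a a"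
    and ev: "\<And>a. a < m \<Longrightarrow> (\<Sum>b<m. if R a b then f b else 0) = \<theta> * f a"
  shows "(\<Sum>j<m * t. adjacency_matrix (closed_blowup R m t) $$ (i, j) * f (j mod m)) =
           (real t * \<theta> - 1) * f (i mod m)"
proof -
  define g where "g b = (if R (i mod m) b then f b else 0)" for b
  have "(\<Sum>j<m * t. adjacency_matrix (closed_blowup R m t) $$ (i, j) * f (j mod m)) =
          (\<Sum>j<m * t. g (j mod m) - (if j = i then f (j mod m) else 0))"
    using assms by (intro sum.cong refl) (auto simp: adjacency_matrix_closed_blowup g_def)
  also have "\<dots> = real t * (\<Sum>b<m. g b) - f (i mod m)"
    using assms by (simp add: sum_subtractf sum_mod_blocks)
  also have "(\<Sum>b<m. g b) = \<theta> * f (i mod m)"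
    unfolding g_def using assms by (intro ev) simp
  finally show ?thesis by (simp add: algebra_simps)
qed

section \<open>The icosahedron\<close>

text \<open>
  Vertices \<open>0, 1, 2\<close> form a face, vertex \<open>3 + i\<close> is the common neighbour of the other two vertices of that face
  that is different from \<open>i\<close>, and \<open>a + 6\<close> is the antipode of \<open>a\<close>. The relation includes the diagonal.
\<close>
definition icosahedron :: "nat \<Rightarrow> nat \<Rightarrow> bool" where
  "icosahedron a b \<longleftrightarrow>
     ((a < 6 \<longleftrightarrow> b < 6) \<longleftrightarrow>
      a mod 6 = b mod 6 \<or>
      (a mod 6 < 3 \<or> b mod 6 < 3) \<and> a mod 6 + 3 \<noteq> b mod 6 \<and> b mod 6 + 3 \<noteq> a mod 6)"

text \<open>
  The coordinates of the vertices of the regular icosahedron with respect to the basis \<open>0, 1, 2\<close>; if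
  \<open>i, j, k\<close> are these three vertices, then vertex \<open>3 + i\<close> is \<open>(j + k) / \<phi> - i\<close> with the golden ratio \<open>\<phi>\<close>.
\<close>
definition icosahedron_coord :: "nat \<Rightarrow> nat \<Rightarrow> real" where
  "icosahedron_coord j a =
     (if a < 6 then 1 else - 1) *
     (if a mod 6 < 3 then if a mod 6 = j then 1 else 0
      else if a mod 6 = j + 3 then - 1 else (sqrt 5 - 1) / 2)"

lemma icosahedron_refl: "icosahedron a a"
  by (simp add: icosahedron_def)

lemma icosahedron_sym: "icosahedron a b \<Longrightarrow> icosahedron b a"
  by (auto simp: icosahedron_def)

lemma less_12_cases:
  fixes a :: nat
  assumes "a < 12"
  shows "a \<in> {0, 1, 2, 3, 4, 5, 6, 7, 8, 9, 10, 11}"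
  using assms by simp presburger

lemma sum_lessThan_12:
  fixes g :: "nat \<Rightarrow> 'a :: comm_monoid_add"
  shows "(\<Sum>b<12. g b) = g 0 + g 1 + g 2 + g 3 + g 4 + g 5 + g 6 + g 7 + g 8 + g 9 + g 10 + g 11"
proof -
  have "{..<12 :: nat} = set [0..<12]" by auto
  also have "[0..<12] = [0, 1, 2, 3, 4, 5, 6, 7, 8, 9, 10, 11 :: nat]"
    by (simp add: upt_rec)
  finally show ?thesis by (simp add: add.assoc)
qed

text \<open>Closed neighbourhoods, tabulated once for arbitrary \<open>g\<close> to serve both
  eigenvalue computations.\<close>

lemma icosahedron_neighbours:
  fixes g :: "nat \<Rightarrow> real"
  shows
    "(\<Sum>b<12. if icosahedron 0 b then g b else 0) = g 0 + g 1 + g 2 + g 4 + g 5 + g 9"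
    "(\<Sum>b<12. if icosahedron 1 b then g b else 0) = g 0 + g 1 + g 2 + g 3 + g 5 + g 10"
    "(\<Sum>b<12. if icosahedron 2 b then g b else 0) = g 0 + g 1 + g 2 + g 3 + g 4 + g 11"
    "(\<Sum>b<12. if icosahedron 3 b then g b else 0) = g 1 + g 2 + g 3 + g 6 + g 10 + g 11"
    "(\<Sum>b<12. if icosahedron 4 b then g b else 0) = g 0 + g 2 + g 4 + g 7 + g 9 + g 11"
    "(\<Sum>b<12. if icosahedron 5 b then g b else 0) = g 0 + g 1 + g 5 + g 8 + g 9 + g 10"
    "(\<Sum>b<12. if icosahedron 6 b then g b else 0) = g 3 + g 6 + g 7 + g 8 + g 10 + g 11"
    "(\<Sum>b<12. if icosahedron 7 b then g b else 0) = g 4 + g 6 + g 7 + g 8 + g 9 + g 11"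
    "(\<Sum>b<12. if icosahedron 8 b then g b else 0) = g 5 + g 6 + g 7 + g 8 + g 9 + g 10"
    "(\<Sum>b<12. if icosahedron 9 b then g b else 0) = g 0 + g 4 + g 5 + g 7 + g 8 + g 9"
    "(\<Sum>b<12. if icosahedron 10 b then g b else 0) = g 1 + g 3 + g 5 + g 6 + g 8 + g 10"
    "(\<Sum>b<12. if icosahedron 11 b then g b else 0) = g 2 + g 3 + g 4 + g 6 + g 7 + g 11"
  by (simp_all add: sum_lessThan_12 icosahedron_def)

lemma icosahedron_degree:
  assumes "a < 12"
  shows "(\<Sum>b<12. if icosahedron a b then 1 else 0) = (6 :: real)"
  using less_12_cases[OF assms]
  by (elim insertE emptyE; hypsubst; simp only: icosahedron_neighbours; simp)

text \<open>The eigenvalue \<open>sqrt 5\<close> is raised by 1 through the diagonal. Each case is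
  an identity in \<open>sqrt 5\<close>, using that its square is 5.\<close>

lemma icosahedron_coord_eigenvector:
  assumes "a < 12" "j < 3"
  shows "(\<Sum>b<12. if icosahedron a b then icosahedron_coord j b else 0) =
           (1 + sqrt 5) * icosahedron_coord j a"
proof -
  have "j = 0 \<or> j = 1 \<or> j = 2" using assms by auto
  with less_12_cases[OF assms(1)] show ?thesis
    by (elim disjE insertE emptyE; hypsubst; simp only: icosahedron_neighbours;
        simp add: icosahedron_coord_def field_simps)
qed

lemma icosahedron_blowup_lambda4:
  assumes "t \<ge> 1"
  shows "real t * (1 + sqrt 5) - 1 \<le> graph_lambda 4 (closed_blowup icosahedron 12 t)"
proof -
  let ?A = "adjacency_matrix (closed_blowup icosahedron 12 t)"
  define \<mu> where "\<mu> = real t * (1 + sqrt 5) - 1"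
  define \<nu> where "\<nu> = real t * 6 - 1"
  have A: "?A \<in> carrier_mat (12 * t) (12 * t)"
    using adjacency_matrix_carrier[of "closed_blowup icosahedron 12 t"] by simp
  \<comment> \<open>Strict inequality keeps \<nu> apart from the three copies of \<mu>, so that four
    roots are counted.\<close>
  have "sqrt 5 < 5" by (rule real_less_lsqrt) auto
  hence "\<mu> < \<nu>" using assms by (simp add: \<mu>_def \<nu>_def)
  have nonzero: "char_poly ?A \<noteq> 0"
    using degree_monic_char_poly[OF A] by auto
  have "[:- \<mu>, 1:] ^ 3 dvd char_poly ?A"
  proof (rule linear_power_dvd_char_poly[OF A, where f = "\<lambda>j i. icosahedron_coord j (i mod 12)"])
    show "(\<Sum>l<12 * t. ?A $$ (i, l) * icosahedron_coord j (l mod 12)) = \<mu> * icosahedron_coord j (i mod 12)"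
      if "i < 12 * t" "j < 3" for i j
      unfolding \<mu>_def using that
      by (intro closed_blowup_eigenvector icosahedron_refl icosahedron_coord_eigenvector) auto
  \<comment> \<open>The normalisation holds because vertices 0, 1, 2 are the basis of the
    coordinates and \<open>i mod 12 = i\<close> for \<open>i < 3\<close>.\<close>
  qed (use assms in \<open>auto simp: icosahedron_coord_def\<close>)
  hence \<mu>: "3 \<le> count (proots (char_poly ?A)) \<mu>"
    using nonzero by (simp add: order_divides)
  have "[:- \<nu>, 1:] ^ 1 dvd char_poly ?A"
  proof (rule linear_power_dvd_char_poly[OF A, where f = "\<lambda>j i. 1"])
    show "(\<Sum>l<12 * t. ?A $$ (i, l) * 1) = \<nu> * 1" if "i < 12 * t" for i
      using closed_blowup_eigenvector[of 12 i t icosahedron "\<lambda>_. 1" 6] that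
      by (simp add: icosahedron_refl icosahedron_degree \<nu>_def)
  qed (use assms in auto)
  hence \<nu>: "1 \<le> count (proots (char_poly ?A)) \<nu>"
    using nonzero order_divides[of \<nu> 1 "char_poly ?A"] by simp
  have "replicate_mset 3 \<mu> + {#\<nu>#} \<subseteq># filter_mset (\<lambda>x. \<mu> \<le> x) (proots (char_poly ?A))"
    using \<mu> \<nu> \<open>\<mu> < \<nu>\<close> by (intro mset_subset_eqI) auto
  from size_mset_mono[OF this] have "4 \<le> size (filter_mset (\<lambda>x. \<mu> \<le> x) (proots (char_poly ?A)))"
    by simp
  from nth_rev_sorted_list_of_multiset_ge[OF _ this] show ?thesis
    by (simp add: graph_lambda_def graph_eigenvalues_def \<mu>_def)
qed

theorem theorem2:
  shows "c_const 4 \<ge> (1 + sqrt 5) / 12"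
proof (rule LIMSEQ_le_const2)
  \<comment> \<open>For \<open>t \<ge> 1\<close> this is the bound on \<open>graph_lambda 4\<close>
    divided by the \<open>12 * t\<close> vertices, split to expose its limit.\<close>
  show "(\<lambda>t. (1 + sqrt 5) / 12 - 1 / 12 * inverse (real t)) \<longlonglongrightarrow> (1 + sqrt 5) / 12"
    by (rule tendsto_eq_intros lim_inverse_n refl | simp)+
  have "(1 + sqrt 5) / 12 - 1 / 12 * inverse (real t) \<le> c_const 4" if t: "t \<ge> 1" for t
  proof -
    have "(1 + sqrt 5) / 12 - 1 / 12 * inverse (real t) = (real t * (1 + sqrt 5) - 1) / real (12 * t)"
      using t by (simp add: field_simps)
    also have "\<dots> \<le> graph_lambda 4 (closed_blowup icosahedron 12 t) / real (12 * t)"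
      using icosahedron_blowup_lambda4[OF t] by (intro divide_right_mono) auto
    also have "\<dots> \<le> c_const 4"
      using c_const_ge[OF pair_graph_closed_blowup[of icosahedron 12 t, OF icosahedron_sym], of 4] t
      by simp
    finally show ?thesis .
  qed
  thus "\<exists>N. \<forall>t\<ge>N. (1 + sqrt 5) / 12 - 1 / 12 * inverse (real t) \<le> c_const 4" by blast
qed

end
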